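(* Let $r$ be any positive integer. (a) There exist a connected, second countable real-analytic manifold $\mathbb{X}$ of dimension $r$ and a real-analytic map $f:\mathbb{X}\to\mathbb{R}^{2r+1}$ such that, for the response $\beta:\mathbb{X}\times\mathbb{R}^{2r+1}\to\mathbb{R}$, $\beta(x,u)=f(x)\cdot u$ (inner product), there is no universal distinguishing set of cardinality $2r$, i.e. $\mathcal{G}_{\beta,2r}=\emptyset$. (b) There exist a connected, second countable real-analytic manifold $\mathbb{X}$ of dimension $r$ and a real-analytic response $\widetilde\beta:\mathbb{X}\times\mathbb{R}\to\mathbb{R}$ (so the input set is one-dimensional) for which there is no universal distinguishing set of cardinality $2r$.
   Context: For a response $\beta:\mathbb{X}\times\mathbb{U}\to\mathbb{R}$, a subset $\mathbb{U}_0\subseteq\mathbb{U}$ is a universal distinguishing set if for all $x_1,x_2\in\mathbb{X}$: whenever $\beta(x_1,u)\neq\beta(x_2,u)$ for some $u\in\mathbb{U}$, then $\beta(x_1,u)\neq\beta(x_2,u)$ for some $u\in\mathbb{U}_0$. For a positive integer $q$, $\mathbb{U}^{(q)}$ denotes the set of $q$-tuples of pairwise distinct elements of $\mathbb{U}$, and $\mathcal{G}_{\beta,q}\subseteq\mathbb{U}^{(q)}$ is the set of those $(u_1,\ldots,u_q)\in\mathbb{U}^{(q)}$ for which $\{u_1,\ldots,u_q\}$ is a universal distinguishing set. *)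

theory Defs
  imports "HOL-Analysis.Analysis"
begin

section \<open>Real-analytic functions on open subsets of \<open>Euclidean_space n\<close>\<close>

text \<open>
  \<open>\<real>\<^sup>n\<close> is \<open>Euclidean_space n\<close>: the functions \<open>nat \<Rightarrow> real\<close> that vanish from index \<open>n\<close> on.
  Multi-indices are encoded in the same way.
\<close>

definition multi_indices :: "nat \<Rightarrow> (nat \<Rightarrow> nat) set" where
  "multi_indices n = {\<alpha>. \<forall>i\<ge>n. \<alpha> i = 0}"

text \<open>
  Only meant for open \<open>S\<close>: near each point of \<open>S\<close>, \<open>g\<close> is the sum of an (unconditionally,
  hence absolutely) convergent power series in \<open>n\<close> variables.
\<close>

definition real_analytic_on :: "nat \<Rightarrow> (nat \<Rightarrow> real) set \<Rightarrow> ((nat \<Rightarrow> real) \<Rightarrow> real) \<Rightarrow> bool" where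
  "real_analytic_on n S g \<longleftrightarrow>
     (\<forall>p\<in>S. \<exists>\<epsilon>>0. \<exists>c :: (nat \<Rightarrow> nat) \<Rightarrow> real.
        \<forall>y\<in>S. (\<forall>i<n. \<bar>y i - p i\<bar> < \<epsilon>) \<longrightarrow>
          ((\<lambda>\<alpha>. c \<alpha> * (\<Prod>i<n. (y i - p i) ^ \<alpha> i)) has_sum g y) (multi_indices n))"


section \<open>Real-analytic manifolds\<close>

text \<open>A chart is given by its domain and its coordinate map.\<close>

type_synonym 'a chart = "'a set \<times> ('a \<Rightarrow> nat \<Rightarrow> real)"

definition chart_on :: "nat \<Rightarrow> 'a topology \<Rightarrow> 'a chart \<Rightarrow> bool" where
  "chart_on n X = (\<lambda>(V, \<phi>).
     openin X V \<and> openin (Euclidean_space n) (\<phi> ` V) \<and>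
     homeomorphic_map (subtopology X V) (subtopology (Euclidean_space n) (\<phi> ` V)) \<phi>)"

definition analytically_compatible :: "nat \<Rightarrow> 'a chart \<Rightarrow> 'a chart \<Rightarrow> bool" where
  "analytically_compatible n = (\<lambda>(V, \<phi>) (W, \<psi>).
     \<forall>i<n. real_analytic_on n (\<phi> ` (V \<inter> W)) (\<lambda>y. \<psi> (inv_into V \<phi> y) i))"

text \<open>
  The atlas is not required to be maximal. Connectedness and second countability are not
  included. A second countable manifold has at most continuum many points, so taking
  \<open>nat \<Rightarrow> real\<close> as the point type \<open>'a\<close> loses no such manifold up to isomorphism.
\<close>

definition real_analytic_manifold :: "nat \<Rightarrow> 'a topology \<Rightarrow> 'a chart set \<Rightarrow> bool" where
  "real_analytic_manifold n X A \<longleftrightarrow>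
     Hausdorff_space X \<and>
     (\<forall>C\<in>A. chart_on n X C) \<and>
     (\<Union>C\<in>A. fst C) = topspace X \<and>
     (\<forall>C\<in>A. \<forall>D\<in>A. analytically_compatible n C D)"

definition real_analytic_function :: "nat \<Rightarrow> 'a chart set \<Rightarrow> ('a \<Rightarrow> real) \<Rightarrow> bool" where
  "real_analytic_function n A g \<longleftrightarrow>
     (\<forall>(V, \<phi>)\<in>A. real_analytic_on n (\<phi> ` V) (\<lambda>y. g (inv_into V \<phi> y)))"

definition real_analytic_map_into ::
    "nat \<Rightarrow> 'a topology \<Rightarrow> 'a chart set \<Rightarrow> nat \<Rightarrow> ('a \<Rightarrow> nat \<Rightarrow> real) \<Rightarrow> bool" where
  "real_analytic_map_into n X A m f \<longleftrightarrow>
     f ` topspace X \<subseteq> topspace (Euclidean_space m) \<and>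
     (\<forall>i<m. real_analytic_function n A (\<lambda>x. f x i))"

text \<open>
  The product atlas: the coordinates of the second factor are placed after the \<open>m\<close> coordinates
  of the first.
\<close>

definition product_atlas :: "nat \<Rightarrow> 'a chart set \<Rightarrow> 'b chart set \<Rightarrow> ('a \<times> 'b) chart set" where
  "product_atlas m A B =
     (\<lambda>((V, \<phi>), (W, \<psi>)).
        (V \<times> W, \<lambda>(x, u) i. if i < m then \<phi> x i else \<psi> u (i - m))) ` (A \<times> B)"

definition real_line_atlas :: "real chart set" where
  "real_line_atlas = {(UNIV, \<lambda>u i. if i = 0 then u else 0)}"


section \<open>Universal distinguishing sets\<close>

definition universal_distinguishing_set ::
    "'x set \<Rightarrow> 'u set \<Rightarrow> ('x \<Rightarrow> 'u \<Rightarrow> real) \<Rightarrow> 'u set \<Rightarrow> bool" where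
  "universal_distinguishing_set X U \<beta> U0 \<longleftrightarrow>
     U0 \<subseteq> U \<and>
     (\<forall>x1\<in>X. \<forall>x2\<in>X. (\<exists>u\<in>U. \<beta> x1 u \<noteq> \<beta> x2 u) \<longrightarrow> (\<exists>u\<in>U0. \<beta> x1 u \<noteq> \<beta> x2 u))"

definition distinct_tuples :: "'u set \<Rightarrow> nat \<Rightarrow> 'u list set" where
  "distinct_tuples U q = {us. length us = q \<and> distinct us \<and> set us \<subseteq> U}"

definition distinguishing_tuples ::
    "'x set \<Rightarrow> 'u set \<Rightarrow> ('x \<Rightarrow> 'u \<Rightarrow> real) \<Rightarrow> nat \<Rightarrow> 'u list set" where
  "distinguishing_tuples X U \<beta> q =
     {us \<in> distinct_tuples U q. universal_distinguishing_set X U \<beta> (set us)}"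

end

(*
  Take X = R^r and f(x) = (cos x_j, sin x_j)_{j<r} followed by the sum of the h(x_j), where
  h(t) = t^2 sin t + t cos t. Every nonzero v in R^{2r+1} is a multiple of a chord f(x) - f(y).
  Indeed, parallel chords of the unit circles are parametrised by a half-angle s in
  [-pi/2, pi/2], and the first 2r coordinates of f(x) - f(y) can be made equal to those of c v
  with c a positive multiple of cos s. Adding a multiple of 2 pi to one coordinate of x leaves
  them unchanged, and h grows along such translates with opposite signs at antipodal angles; so
  the defect in the last coordinate gets opposite signs at s = -pi/2 and s = pi/2, and it
  vanishes for some s in between.

  For any 2r inputs there is a nonzero v orthogonal to their 2r vectors in R^{2r+1}, and the end
  points of a chord in the direction v are not distinguished by these inputs. For a
  one-dimensional input, u is replaced by the point (1, u, ..., u^{2r}) of the moment curve.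
*)

theory Submission
  imports Defs "HOL-Complex_Analysis.Complex_Analysis" "HOL-Real_Asymp.Real_Asymp"
begin

section \<open>Real-analyticity\<close>

text \<open>The expansion about each centre converges on the whole line, so no radii have to be
  tracked when such functions of different coordinates are multiplied. \<open>has_sum\<close>
  matches the unconditional convergence in \<open>real_analytic_on\<close>.\<close>

definition entire_real :: "(real \<Rightarrow> real) \<Rightarrow> bool" where
  "entire_real g \<longleftrightarrow> (\<forall>p. \<exists>a. \<forall>t. ((\<lambda>k. a k * (t - p) ^ k) has_sum g t) (UNIV :: nat set))"

text \<open>The Taylor series of the holomorphic extension \<open>G\<close> at a real centre
  converges on every disc. At real arguments its real part is a power series whose coefficients are
  the real parts of the Taylor coefficients.\<close>

lemma entire_real_of_holomorphic:
  assumes "G holomorphic_on UNIV" and G: "\<And>t. G (of_real t) = of_real (g t)"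
  shows "entire_real g"
  unfolding entire_real_def
proof
  fix p :: real
  define a where "a k = Re ((deriv ^^ k) G (of_real p) / fact k)" for k
  have sums: "(\<lambda>k. a k * (t - p) ^ k) sums g t" for t
  proof -
    have "(\<lambda>k. (deriv ^^ k) G (of_real p) / fact k * (of_real t - of_real p) ^ k) sums G (of_real t)"
    proof (rule holomorphic_power_series)
      show "G holomorphic_on ball (of_real p) (\<bar>t - p\<bar> + 1)"
        using assms(1) by (rule holomorphic_on_subset) simp
      show "of_real t \<in> ball (of_real p :: complex) (\<bar>t - p\<bar> + 1)"
        by (simp add: dist_norm abs_minus_commute flip: of_real_diff)
    qed
    moreover have "Re (z * (of_real t - of_real p) ^ k) = Re z * (t - p) ^ k" for z k
      by (simp flip: of_real_diff of_real_power)
    ultimately show ?thesis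
      using sums_Re by (fastforce simp only: a_def G Re_complex_of_real)
  qed
  have "((\<lambda>k. a k * (t - p) ^ k) has_sum g t) UNIV" for t
  proof (rule norm_summable_imp_has_sum[OF _ sums])
    \<comment> \<open>Convergence at a point farther from the centre than \<open>t\<close> gives
      absolute convergence at \<open>t\<close>.\<close>
    have "summable (\<lambda>k. a k * (\<bar>t - p\<bar> + 1) ^ k)"
      using sums_summable[OF sums[of "p + \<bar>t - p\<bar> + 1"]] by (simp add: algebra_simps)
    then show "summable (\<lambda>k. norm (a k * (t - p) ^ k))"
      by (rule powser_insidea) simp
  qed
  then show "\<exists>a. \<forall>t. ((\<lambda>k. a k * (t - p) ^ k) has_sum g t) UNIV"
    by blast
qed

lemma entire_real_const: "entire_real (\<lambda>t. c)"
  by (rule entire_real_of_holomorphic[of "\<lambda>z. of_real c"]) (auto intro!: holomorphic_intros)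

lemma entire_real_power: "entire_real (\<lambda>t. t ^ k)"
  by (rule entire_real_of_holomorphic[of "\<lambda>z. z ^ k"]) (auto intro!: holomorphic_intros)

lemma entire_real_ident: "entire_real (\<lambda>t. t)"
  using entire_real_power[of 1] by simp

lemma entire_real_cos: "entire_real cos"
  by (rule entire_real_of_holomorphic[of cos]) (auto intro!: holomorphic_intros simp: cos_of_real)

lemma entire_real_sin: "entire_real sin"
  by (rule entire_real_of_holomorphic[of sin]) (auto intro!: holomorphic_intros simp: sin_of_real)

section \<open>Analytic functions of several variables\<close>

text \<open>Induction on the number of factors: real sums in the sense of \<open>has_sum\<close>
  converge absolutely, so two of them multiply to a sum over pairs, and a multi-index of length n +
  1 is a pair of one of length n and an exponent.\<close>

lemma has_sum_prod_multi_indices: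
  fixes F :: "nat \<Rightarrow> nat \<Rightarrow> real"
  assumes "\<And>i. i < n \<Longrightarrow> (F i has_sum s i) UNIV"
  shows "((\<lambda>\<alpha>. \<Prod>i<n. F i (\<alpha> i)) has_sum (\<Prod>i<n. s i)) (multi_indices n)"
  using assms
proof (induction n)
  case 0
  have "multi_indices 0 = {\<lambda>_. 0}"
    by (auto simp: multi_indices_def)
  then show ?case
    by (simp add: has_sum_finiteI)
next
  case (Suc n)
  define P where "P \<alpha> = (\<Prod>i<n. F i (\<alpha> i))" for \<alpha>
  define p where "p = (\<Prod>i<n. s i)"
  have P: "(P has_sum p) (multi_indices n)"
    using Suc by (simp add: P_def[abs_def] p_def)
  have F: "(F n has_sum s n) UNIV"
    using Suc by simp
  have absP: "(\<lambda>\<alpha>. \<bar>P \<alpha>\<bar>) summable_on multi_indices n"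
    and absF: "(\<lambda>k. \<bar>F n k\<bar>) summable_on UNIV"
    using summable_on_iff_abs_summable_on_real[THEN iffD1, OF has_sum_imp_summable[OF P]]
      summable_on_iff_abs_summable_on_real[THEN iffD1, OF has_sum_imp_summable[OF F]]
    by simp_all
  have "(\<lambda>z. norm (case z of (\<alpha>, k) \<Rightarrow> P \<alpha> * F n k)) summable_on (multi_indices n \<times> UNIV)"
    by (subst Infinite_Sum.abs_summable_on_Sigma_iff)
      (simp add: abs_mult infsum_cmult_right' absP absF summable_on_cmult_right summable_on_cmult_left)
  then have summable: "(\<lambda>(\<alpha>, k). P \<alpha> * F n k) summable_on (multi_indices n \<times> UNIV)"
    by (rule abs_summable_summable)
  have "((\<lambda>(\<alpha>, k). P \<alpha> * F n k) has_sum p * s n) (multi_indices n \<times> UNIV)"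
  proof (rule has_sum_SigmaI[OF _ _ summable])
    show "((\<lambda>k. case (\<alpha>, k) of (\<alpha>, k) \<Rightarrow> P \<alpha> * F n k) has_sum P \<alpha> * s n) UNIV" for \<alpha>
      using has_sum_cmult_right[OF F] by simp
    show "((\<lambda>\<alpha>. P \<alpha> * s n) has_sum p * s n) (multi_indices n)"
      using has_sum_cmult_left[OF P] by simp
  qed
  also have "?this \<longleftrightarrow> ((\<lambda>\<alpha>. \<Prod>i<Suc n. F i (\<alpha> i)) has_sum p * s n) (multi_indices (Suc n))"
  \<comment> \<open>Members of \<open>multi_indices n\<close> are 0 at position n, so this entry is
    free to hold the new exponent.\<close>
  proof (rule has_sum_reindex_bij_witness[where j = "\<lambda>(\<alpha>, k). \<alpha>(n := k)" and i = "\<lambda>\<alpha>. (\<alpha>(n := 0), \<alpha> n)"])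
    fix \<alpha>k :: "(nat \<Rightarrow> nat) \<times> nat"
    assume "\<alpha>k \<in> multi_indices n \<times> UNIV"
    then show "(case \<alpha>k of (\<alpha>, k) \<Rightarrow> \<alpha>(n := k)) \<in> multi_indices (Suc n)"
      by (auto simp: multi_indices_def)
    have "(\<Prod>i<n. F i ((\<alpha>(n := k)) i)) = (\<Prod>i<n. F i (\<alpha> i))" for \<alpha> k
      by (rule prod.cong) auto
    then show "(\<Prod>i<Suc n. F i ((case \<alpha>k of (\<alpha>, k) \<Rightarrow> \<alpha>(n := k)) i)) = (case \<alpha>k of (\<alpha>, k) \<Rightarrow> P \<alpha> * F n k)"
      by (auto simp: P_def split: prod.splits)
  qed (auto simp: multi_indices_def fun_eq_iff)
  finally show ?case
    by (simp add: p_def)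
qed

text \<open>The coefficient at a multi-index is the product of the one-variable coefficients. As
  these series converge everywhere, any radius serves, and 1 is taken.\<close>

lemma real_analytic_on_prod:
  assumes "\<And>i. i < n \<Longrightarrow> entire_real (g i)"
  shows "real_analytic_on n S (\<lambda>y. \<Prod>i<n. g i (y i))"
  unfolding real_analytic_on_def
proof
  fix p :: "nat \<Rightarrow> real"
  have "\<forall>i\<in>{..<n}. \<exists>b. \<forall>t. ((\<lambda>k. b k * (t - p i) ^ k) has_sum g i t) UNIV"
    using assms unfolding entire_real_def by blast
  from bchoice[OF this]
  obtain a where a: "\<And>i t. i < n \<Longrightarrow> ((\<lambda>k. a i k * (t - p i) ^ k) has_sum g i t) UNIV"
    by auto
  have "((\<lambda>\<alpha>. (\<Prod>i<n. a i (\<alpha> i)) * (\<Prod>i<n. (y i - p i) ^ \<alpha> i)) has_sum (\<Prod>i<n. g i (y i)))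
      (multi_indices n)" for y
    using has_sum_prod_multi_indices[of n "\<lambda>i k. a i k * (y i - p i) ^ k" "\<lambda>i. g i (y i)"] a
    by (simp add: prod.distrib)
  then show "\<exists>\<epsilon>>0. \<exists>c. \<forall>y\<in>S. (\<forall>i<n. \<bar>y i - p i\<bar> < \<epsilon>) \<longrightarrow>
      ((\<lambda>\<alpha>. c \<alpha> * (\<Prod>i<n. (y i - p i) ^ \<alpha> i)) has_sum (\<Prod>i<n. g i (y i))) (multi_indices n)"
    by (intro exI[of _ "1 :: real"] conjI zero_less_one exI[of _ "\<lambda>\<alpha>. \<Prod>i<n. a i (\<alpha> i)"] ballI impI)
qed

lemma real_analytic_on_coordinate:
  assumes "entire_real g" "j < n"
  shows "real_analytic_on n S (\<lambda>y. g (y j))"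
proof -
  have "real_analytic_on n S (\<lambda>y. \<Prod>i<n. (if i = j then g else (\<lambda>_. 1)) (y i))"
    by (rule real_analytic_on_prod) (auto simp: assms entire_real_const)
  moreover have "(\<Prod>i<n. (if i = j then g else (\<lambda>_. 1)) (y i)) = g (y j)" for y
    using assms(2) by (simp add: if_distribR cong: if_cong)
  ultimately show ?thesis
    by simp
qed

text \<open>Serves the terms of the second response, each a function of one coordinate of x times a
  power of the input.\<close>

lemma real_analytic_on_mult_coordinates:
  assumes "entire_real g" "entire_real h" "j < n" "l < n" "j \<noteq> l"
  shows "real_analytic_on n S (\<lambda>y. g (y j) * h (y l))"
proof -
  define G where "G i = (if i = j then g else if i = l then h else (\<lambda>_. 1))" for i
  have "real_analytic_on n S (\<lambda>y. \<Prod>i<n. G i (y i))"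
    by (rule real_analytic_on_prod) (auto simp: G_def assms entire_real_const)
  moreover have "(\<Prod>i<n. G i (y i)) = g (y j) * h (y l)" for y
  proof -
    have "(\<Prod>i<n. G i (y i)) = (\<Prod>i\<in>{j, l}. G i (y i))"
      by (rule prod.mono_neutral_right) (use assms in \<open>auto simp: G_def\<close>)
    then show ?thesis
      using assms(5) by (simp add: G_def)
  qed
  ultimately show ?thesis
    by simp
qed

lemma real_analytic_on_add:
  assumes "real_analytic_on n S g" "real_analytic_on n S h"
  shows "real_analytic_on n S (\<lambda>y. g y + h y)"
  unfolding real_analytic_on_def
proof
  fix p assume p: "p \<in> S"
  obtain \<epsilon>1 c1 where \<epsilon>1: "\<epsilon>1 > 0"
    and c1: "\<And>y. y \<in> S \<Longrightarrow> \<forall>i<n. \<bar>y i - p i\<bar> < \<epsilon>1 \<Longrightarrow>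
        ((\<lambda>\<alpha>. c1 \<alpha> * (\<Prod>i<n. (y i - p i) ^ \<alpha> i)) has_sum g y) (multi_indices n)"
    using assms(1) p unfolding real_analytic_on_def by blast
  obtain \<epsilon>2 c2 where \<epsilon>2: "\<epsilon>2 > 0"
    and c2: "\<And>y. y \<in> S \<Longrightarrow> \<forall>i<n. \<bar>y i - p i\<bar> < \<epsilon>2 \<Longrightarrow>
        ((\<lambda>\<alpha>. c2 \<alpha> * (\<Prod>i<n. (y i - p i) ^ \<alpha> i)) has_sum h y) (multi_indices n)"
    using assms(2) p unfolding real_analytic_on_def by blast
  have "((\<lambda>\<alpha>. (c1 \<alpha> + c2 \<alpha>) * (\<Prod>i<n. (y i - p i) ^ \<alpha> i)) has_sum (g y + h y)) (multi_indices n)"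
    if "y \<in> S" "\<forall>i<n. \<bar>y i - p i\<bar> < min \<epsilon>1 \<epsilon>2" for y
    using has_sum_add[OF c1[of y] c2[of y]] that by (simp add: algebra_simps)
  then show "\<exists>\<epsilon>>0. \<exists>c. \<forall>y\<in>S. (\<forall>i<n. \<bar>y i - p i\<bar> < \<epsilon>) \<longrightarrow>
      ((\<lambda>\<alpha>. c \<alpha> * (\<Prod>i<n. (y i - p i) ^ \<alpha> i)) has_sum (g y + h y)) (multi_indices n)"
    using \<epsilon>1 \<epsilon>2
    by (intro exI[of _ "min \<epsilon>1 \<epsilon>2"] conjI exI[of _ "\<lambda>\<alpha>. c1 \<alpha> + c2 \<alpha>"] ballI impI) simp_all
qed

lemma real_analytic_on_sum:
  assumes "finite I" "\<And>i. i \<in> I \<Longrightarrow> real_analytic_on n S (g i)"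
  shows "real_analytic_on n S (\<lambda>y. \<Sum>i\<in>I. g i y)"
  using assms
proof (induction I rule: finite_induct)
  case empty
  show ?case
    unfolding real_analytic_on_def by (auto intro!: exI[of _ "1 :: real"] exI[of _ "\<lambda>_. 0"])
next
  case (insert i I)
  then show ?case
    by (simp add: real_analytic_on_add)
qed

lemma real_analytic_on_cong:
  assumes "\<And>y. y \<in> S \<Longrightarrow> g y = h y"
  shows "real_analytic_on n S g \<longleftrightarrow> real_analytic_on n S h"
  unfolding real_analytic_on_def by (simp add: assms)


section \<open>Euclidean space as a real-analytic manifold\<close>

definition Euclidean_atlas :: "nat \<Rightarrow> (nat \<Rightarrow> real) chart set" where
  "Euclidean_atlas n = {(topspace (Euclidean_space n), \<lambda>x. x)}"

lemma real_analytic_function_Euclidean_atlas: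
  "real_analytic_function n (Euclidean_atlas n) g \<longleftrightarrow>
    real_analytic_on n (topspace (Euclidean_space n)) g"
proof -
  let ?V = "topspace (Euclidean_space n)"
  have "real_analytic_on n ?V (\<lambda>y. g (inv_into ?V (\<lambda>x. x) y)) \<longleftrightarrow> real_analytic_on n ?V g"
    by (simp add: inv_into_f_f[of "\<lambda>x. x", OF inj_on_id2] cong: real_analytic_on_cong)
  then show ?thesis
    by (simp add: real_analytic_function_def Euclidean_atlas_def)
qed

lemma real_analytic_manifold_Euclidean:
  "real_analytic_manifold n (Euclidean_space n) (Euclidean_atlas n)"
proof -
  let ?V = "topspace (Euclidean_space n)"
  have "real_analytic_on n ?V (\<lambda>y. inv_into ?V (\<lambda>x. x) y i)" if "i < n" for i
  proof -
    have "real_analytic_on n ?V (\<lambda>y. y i)"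
      using real_analytic_on_coordinate[OF entire_real_ident that] .
    moreover have "inv_into ?V (\<lambda>x. x) y = y" if "y \<in> ?V" for y
      using inv_into_f_f[of "\<lambda>x. x", OF inj_on_id2 that] .
    ultimately show ?thesis
      by (simp cong: real_analytic_on_cong)
  qed
  then show ?thesis
    by (auto simp: real_analytic_manifold_def Euclidean_atlas_def chart_on_def
        analytically_compatible_def Hausdorff_Euclidean_space homeomorphic_map_id[unfolded id_def])
qed

lemma second_countable_euclidean:
  "second_countable (euclidean :: 'a :: second_countable_topology topology)"
proof -
  obtain B :: "'a set set" where "countable B" "topological_basis B"
    using ex_countable_basis by blast
  then show ?thesis
    unfolding second_countable_def
    by (intro exI[of _ B]) (auto simp: topological_basis_open elim!: topological_basisE)
qed

lemma second_countable_Euclidean_space: "second_countable (Euclidean_space n)"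
  unfolding Euclidean_space_def
  by (intro second_countable_subtopology) (simp add: euclidean_product_topology second_countable_euclidean)

section \<open>Functions on the product with the real line\<close>

text \<open>The product atlas has the single chart \<open>\<phi>\<close>, which appends u as
  coordinate n; its inverse \<open>\<kappa>\<close> splits a point of the image back into x and
  u.\<close>

lemma real_analytic_function_product_real_line:
  assumes "real_analytic_on (n + 1) (topspace (Euclidean_space (n + 1)))
      (\<lambda>y. g (\<lambda>i. if i < n then y i else 0) (y n))"
  shows "real_analytic_function (n + 1) (product_atlas n (Euclidean_atlas n) real_line_atlas)
      (\<lambda>(x, u). g x u)"
proof -
  define V where "V = topspace (Euclidean_space n) \<times> (UNIV :: real set)"
  define \<phi> :: "(nat \<Rightarrow> real) \<times> real \<Rightarrow> nat \<Rightarrow> real"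
    where "\<phi> = (\<lambda>(x, u) i. if i < n then x i else if i - n = 0 then u else 0)"
  define \<kappa> :: "(nat \<Rightarrow> real) \<Rightarrow> (nat \<Rightarrow> real) \<times> real"
    where "\<kappa> y = ((\<lambda>i. if i < n then y i else 0), y n)" for y
  have \<kappa>\<phi>: "\<kappa> (\<phi> z) = z" if "z \<in> V" for z
    using that by (auto simp: \<kappa>_def \<phi>_def V_def topspace_Euclidean_space fun_eq_iff)
  then have inj: "inj_on \<phi> V"
    by (metis inj_on_inverseI)
  have inv: "inv_into V \<phi> y = \<kappa> y" if "y \<in> \<phi> ` V" for y
    using that \<kappa>\<phi> inj by auto
  \<comment> \<open>An inclusion is enough here, since analyticity in the sense of
    \<open>real_analytic_on\<close> passes to subsets.\<close>
  have "\<phi> ` V \<subseteq> topspace (Euclidean_space (n + 1))"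
    by (auto simp: \<phi>_def V_def topspace_Euclidean_space)
  then have "real_analytic_on (n + 1) (\<phi> ` V) (\<lambda>y. g (\<lambda>i. if i < n then y i else 0) (y n))"
    using assms unfolding real_analytic_on_def by (meson subsetD)
  then have "real_analytic_on (n + 1) (\<phi> ` V) (\<lambda>y. (\<lambda>(x, u). g x u) (inv_into V \<phi> y))"
    by (subst real_analytic_on_cong[of _ _ "\<lambda>y. g (\<lambda>i. if i < n then y i else 0) (y n)"])
      (auto simp: inv \<kappa>_def)
  moreover have "product_atlas n (Euclidean_atlas n) real_line_atlas = {(V, \<phi>)}"
    by (auto simp: product_atlas_def Euclidean_atlas_def real_line_atlas_def V_def \<phi>_def)
  ultimately show ?thesis
    by (simp add: real_analytic_function_def)
qed

section \<open>Chords in every direction\<close>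

text \<open>Gaussian elimination: a pivot \<open>p\<close> clears the last coordinate of the other
  vectors, which leaves a problem with one vector and one dimension fewer.\<close>

lemma ex_orthogonal:
  fixes S :: "(nat \<Rightarrow> real) set"
  assumes "finite S" "card S < N"
  shows "\<exists>v. (\<exists>i<N. v i \<noteq> 0) \<and> (\<forall>u\<in>S. (\<Sum>i<N. v i * u i) = 0)"
  using assms
proof (induction N arbitrary: S)
  case 0
  then show ?case by simp
next
  case (Suc N)
  show ?case
  proof (cases "\<forall>u\<in>S. u N = 0")
    case True
    then show ?thesis
      by (intro exI[of _ "\<lambda>i. if i = N then 1 else 0"]) auto
  next
    case False
    then obtain p where p: "p \<in> S" "p N \<noteq> 0"
      by blast
    define S' where "S' = (\<lambda>u i. u i - u N / p N * p i) ` (S - {p})"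
    have "card S' \<le> card (S - {p})"
      unfolding S'_def using Suc.prems by (intro card_image_le) simp
    then have "card S' < N"
      using Suc.prems p card_Diff1_less[of S p] by linarith
    moreover have "finite S'"
      using Suc.prems by (simp add: S'_def)
    ultimately obtain v where v: "\<exists>i<N. v i \<noteq> 0" "\<forall>u\<in>S'. (\<Sum>i<N. v i * u i) = 0"
      using Suc.IH by blast
    \<comment> \<open>The only last entry that makes the extended vector orthogonal to
      \<open>p\<close>; orthogonality to the rest of \<open>S\<close> then follows from that to
      \<open>S'\<close>.\<close>
    define c where "c = - (\<Sum>i<N. v i * p i) / p N"
    have split: "(\<Sum>i<Suc N. (v(N := c)) i * u i) = (\<Sum>i<N. v i * u i) + c * u N" for u
      by simp
    have "(\<Sum>i<N. v i * u i) + c * u N = 0" if u: "u \<in> S" for u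
    proof (cases "u = p")
      case True
      then show ?thesis
        using p by (simp add: c_def)
    next
      case False
      then have "(\<Sum>i<N. v i * (u i - u N / p N * p i)) = 0"
        using u v by (auto simp: S'_def)
      then have "(\<Sum>i<N. v i * u i) = u N / p N * (\<Sum>i<N. v i * p i)"
        by (simp add: right_diff_distrib sum_subtractf sum_distrib_left mult_ac)
      then show ?thesis
        by (simp add: c_def)
    qed
    then have "\<forall>u\<in>S. (\<Sum>i<Suc N. (v(N := c)) i * u i) = 0"
      unfolding split by blast
    moreover have "\<exists>i<Suc N. (v(N := c)) i \<noteq> 0"
      using v(1) by (metis fun_upd_other less_Suc_eq less_irrefl)
    ultimately show ?thesis
      by blast
  qed
qed

section \<open>The height function along translates by 2 pi\<close>

text \<open>Along translates by 2 pi, the sign of sin t decides the growth through the quadratic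
  term. The linear term takes over where the sine vanishes, so no angle is degenerate.\<close>

definition height :: "real \<Rightarrow> real" where
  "height t = t\<^sup>2 * sin t + t * cos t"

lemma sin_cos_add_2pi_nat:
  "sin (a + 2 * pi * of_nat k) = sin (a :: real)" "cos (a + 2 * pi * of_nat k) = cos a"
  using sin_2npi[of k] cos_2npi[of k] by (simp_all add: sin_add cos_add mult_ac)

lemma height_add_of_nat: "height (a + 2 * pi * of_nat k) =
    (a + 2 * pi * of_nat k)\<^sup>2 * sin a + (a + 2 * pi * of_nat k) * cos a"
  by (simp add: height_def sin_cos_add_2pi_nat)

text \<open>Passing to the antipode negates both sine and cosine, hence the leading coefficient of
  the polynomial in k, whether it is the quadratic or the linear one.\<close>

lemma height_lift_diverges:
  "filterlim (\<lambda>k. height (a + 2 * pi * of_nat k)) at_top sequentially \<and>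
     filterlim (\<lambda>k. height (a - pi + 2 * pi * of_nat k)) at_bot sequentially \<or>
   filterlim (\<lambda>k. height (a + 2 * pi * of_nat k)) at_bot sequentially \<and>
     filterlim (\<lambda>k. height (a - pi + 2 * pi * of_nat k)) at_top sequentially"
proof -
  have *: "filterlim (\<lambda>k. (b + 2 * pi * of_nat k)\<^sup>2 * s + (b + 2 * pi * of_nat k) * c) at_top sequentially"
    if "s > 0 \<or> s = 0 \<and> c > 0" for s c b :: real
    using that
  proof
    assume "s > 0"
    then show ?thesis
      using pi_gt_zero by real_asymp
  next
    assume "s = 0 \<and> c > 0"
    then show ?thesis
      using pi_gt_zero by (simp; real_asymp)
  qed
  have **: "filterlim (\<lambda>k. (b + 2 * pi * of_nat k)\<^sup>2 * s + (b + 2 * pi * of_nat k) * c) at_bot sequentially"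
    if "s < 0 \<or> s = 0 \<and> c < 0" for s c b :: real
    using *[of "-s" "-c" b] that by (simp add: filterlim_uminus_at_bot)
  have antipode: "sin (a - pi) = - sin a" "cos (a - pi) = - cos a"
    by (simp_all add: sin_diff cos_diff)
  \<comment> \<open>Sine and cosine have no common zero.\<close>
  have "(sin a > 0 \<or> sin a = 0 \<and> cos a > 0) \<or> (sin a < 0 \<or> sin a = 0 \<and> cos a < 0)"
    using sin_cos_squared_add[of a] by (cases "sin a = 0"; cases "cos a = 0") auto
  then show ?thesis
  proof
    assume "sin a > 0 \<or> sin a = 0 \<and> cos a > 0"
    then show ?thesis
      unfolding height_add_of_nat antipode by - (rule disjI1, rule conjI; (rule * | rule **); force)
  next
    assume "sin a < 0 \<or> sin a = 0 \<and> cos a < 0"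
    then show ?thesis
      unfolding height_add_of_nat antipode by - (rule disjI2, rule conjI; (rule * | rule **); force)
  qed
qed

section \<open>Chords of the torus helix\<close>

definition torus_helix :: "nat \<Rightarrow> (nat \<Rightarrow> real) \<Rightarrow> nat \<Rightarrow> real" where
  "torus_helix r x i =
     (if i < 2 * r then if even i then cos (x (i div 2)) else sin (x (i div 2))
      else if i = 2 * r then \<Sum>j<r. height (x j) else 0)"

lemma less_double_cases:
  assumes "(i :: nat) < 2 * r"
  obtains j where "j < r" "i = 2 * j" | j where "j < r" "i = 2 * j + 1"
  using assms by (cases "even i") (auto elim!: evenE oddE)

text \<open>For a vertical direction, one full turn of a single angle gives the chord. Otherwise the
  intermediate value theorem is applied to the defect \<open>G\<close> of the last coordinate, as
  the half-angle s runs over [-pi/2, pi/2].\<close>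

lemma torus_helix_chord:
  fixes v :: "nat \<Rightarrow> real"
  assumes "\<exists>i<2 * r + 1. v i \<noteq> 0" "r > 0"
  obtains x y c where "x \<in> topspace (Euclidean_space r)" "y \<in> topspace (Euclidean_space r)"
    "c \<noteq> 0" "\<And>i. i < 2 * r + 1 \<Longrightarrow> torus_helix r x i - torus_helix r y i = c * v i"
proof (cases "\<forall>i<2 * r. v i = 0")
  case True
  \<comment> \<open>A full turn fixes all circle coordinates but changes the height from 0 to 2
    pi.\<close>
  define x :: "nat \<Rightarrow> real" where "x j = (if j = 0 then 2 * pi else 0)" for j
  have "v (2 * r) \<noteq> 0"
    using assms(1) True by (metis Suc_eq_plus1 less_SucE)
  moreover have "height 0 = 0" "height (2 * pi) = 2 * pi"
    by (simp_all add: height_def)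
  moreover from this have "(\<Sum>j<r. height (x j)) = 2 * pi"
    using assms(2) by (simp add: x_def if_distrib[of height] cong: if_cong)
  moreover have "cos (x j) = 1" "sin (x j) = 0" for j
    by (simp_all add: x_def)
  ultimately have "torus_helix r x i - torus_helix r (\<lambda>_. 0) i = (2 * pi / v (2 * r)) * v i"
    if "i < 2 * r + 1" for i
    using that True by (cases "i = 2 * r") (simp_all add: torus_helix_def)
  then show ?thesis
    using assms(2) \<open>v (2 * r) \<noteq> 0\<close>
    by (intro that[of x "\<lambda>_. 0" "2 * pi / v (2 * r)"]) (auto simp: x_def topspace_Euclidean_space)
next
  case False
  define z where "z j = Complex (v (2 * j)) (v (2 * j + 1))" for j
  define R where "R j = cmod (z j)" for j
  define \<theta> where "\<theta> j = Arg (z j)" for j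
  have "Re (z j) = R j * cos (\<theta> j)" "Im (z j) = R j * sin (\<theta> j)" for j
    using Re_rcis[of "R j" "\<theta> j"] Im_rcis[of "R j" "\<theta> j"]
    by (simp_all add: R_def \<theta>_def rcis_cmod_Arg)
  then have polar: "v (2 * j) = R j * cos (\<theta> j)" "v (2 * j + 1) = R j * sin (\<theta> j)" for j
    by (simp_all add: z_def)
  \<comment> \<open>Dividing by the largest radius puts all factors \<open>R j / M\<close> into
    [0, 1], which keeps the arguments of arccos in its domain.\<close>
  define M where "M = Max (R ` {..<r})"
  have fin: "finite (R ` {..<r})" "R ` {..<r} \<noteq> {}"
    using assms(2) by auto
  \<comment> \<open>At \<open>j0\<close> the factor is 1, so the half-angle there can be s itself,
    sign included, where arccos (cos s) would only give the absolute value of s. The two ends of the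
    interval thus lead to antipodal angles at \<open>j0\<close>.\<close>
  obtain j0 where j0: "j0 < r" "R j0 = M"
    using Max_in[OF fin] by (auto simp: M_def)
  have R: "0 \<le> R j" "j < r \<Longrightarrow> R j \<le> M" for j
    using fin by (auto simp: M_def R_def)
  have "M > 0"
  proof -
    obtain i where i: "i < 2 * r" "v i \<noteq> 0"
      using False by blast
    then obtain j where "j < r" "R j \<noteq> 0"
      using polar by (elim less_double_cases) (metis mult_zero_left)+
    then show ?thesis
      using R by (metis order_le_less order_less_le_trans)
  qed
  \<comment> \<open>the unit vectors at the angles \<open>\<theta> + \<psi>\<close> and \<open>\<theta> + pi - \<psi>\<close> differ by \<open>2 * cos \<psi>\<close> times the one at \<open>\<theta>\<close>\<close>
  define \<psi> where "\<psi> s j = (if j = j0 then s else arccos (R j / M * cos s))" for s j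
  \<comment> \<open>\<open>k\<close> counts the extra turns at \<open>j0\<close>. The right-hand
    sides are the heights of the other end point at s = pi/2 and s = -pi/2; they do not depend on
    \<open>k\<close>, so the divergence in opposite directions beats both at once.\<close>
  obtain k :: nat where k:
    "height (\<theta> j0 + pi/2 + 2 * pi * of_nat k) > height (\<theta> j0 + pi/2) \<and>
     height (\<theta> j0 + pi/2 - pi + 2 * pi * of_nat k) < height (\<theta> j0 + pi/2 + pi) \<or>
     height (\<theta> j0 + pi/2 + 2 * pi * of_nat k) < height (\<theta> j0 + pi/2) \<and>
     height (\<theta> j0 + pi/2 - pi + 2 * pi * of_nat k) > height (\<theta> j0 + pi/2 + pi)"
  proof -
    have "\<exists>k::nat. f k > c \<and> g k < d"
      if "filterlim f at_top sequentially" "filterlim g at_bot sequentially"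
      for f g :: "nat \<Rightarrow> real" and c d
    proof -
      have "eventually (\<lambda>k. f k > c) sequentially" "eventually (\<lambda>k. g k < d) sequentially"
        using that by (auto simp: filterlim_at_top_dense filterlim_at_bot_dense)
      then have "eventually (\<lambda>k. f k > c \<and> g k < d) sequentially"
        by (rule eventually_conj)
      then show ?thesis
        by (rule eventually_happens'[rotated]) simp
    qed
    then show ?thesis
      using height_lift_diverges[of "\<theta> j0 + pi/2"] that by meson
  qed
  define X where "X s j = (if j < r then \<theta> j + \<psi> s j + (if j = j0 then 2 * pi * of_nat k else 0) else 0)" for s j
  define Y where "Y s j = (if j < r then \<theta> j + pi - \<psi> s j else 0)" for s j
  \<comment> \<open>The last coordinate of the chord minus the value that it must have,
    \<open>2 * cos s / M\<close> being the scale forced by the first 2r coordinates.\<close>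
  define G where "G s = (\<Sum>j<r. height (X s j) - height (Y s j)) - 2 * cos s / M * v (2 * r)" for s
  have cos_bounds: "0 \<le> R j / M * cos s" "R j / M * cos s \<le> 1"
    if "s \<in> {-pi/2..pi/2}" "j < r" for s j
  proof -
    have "0 \<le> cos s"
      using that by (intro cos_ge_zero) auto
    then show "0 \<le> R j / M * cos s"
      using R \<open>M > 0\<close> by simp
    show "R j / M * cos s \<le> 1"
      using R that \<open>M > 0\<close> \<open>0 \<le> cos s\<close> by (intro mult_le_one) auto
  qed
  have cos_\<psi>: "cos (\<psi> s j) = R j / M * cos s" if "s \<in> {-pi/2..pi/2}" "j < r" for s j
    using cos_bounds[OF that] \<open>M > 0\<close> j0 by (simp add: \<psi>_def cos_arccos)
  have "continuous_on {-pi/2..pi/2} (\<lambda>s. \<psi> s j)" if "j < r" for j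
  proof (cases "j = j0")
    case False
    have "continuous_on {-pi/2..pi/2} (\<lambda>s. arccos (R j / M * cos s))"
    proof (rule continuous_on_arccos)
      show "\<forall>s\<in>{-pi/2..pi/2}. -1 \<le> R j / M * cos s \<and> R j / M * cos s \<le> 1"
        using cos_bounds[OF _ that] by (meson neg_le_0_iff_le order_trans zero_le_one)
    qed (intro continuous_intros)
    with False show ?thesis
      by (simp add: \<psi>_def)
  qed (simp add: \<psi>_def continuous_on_id)
  then have cont: "continuous_on {-pi/2..pi/2} G"
    unfolding G_def X_def Y_def height_def by (auto intro!: continuous_intros simp: \<open>M > 0\<close>[THEN less_imp_neq, symmetric])
  \<comment> \<open>If cos s = 0, then every half-angle other than that at \<open>j0\<close> is
    arccos 0 = pi/2, and \<theta> + \<psi> and \<theta> + pi - \<psi> coincide.\<close>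
  have sum_j0: "(\<Sum>j<r. height (X s j) - height (Y s j)) = height (X s j0) - height (Y s j0)"
    if "cos s = 0" for s
  proof -
    have "X s j = Y s j" if "j < r" "j \<noteq> j0" for j
      using that \<open>cos s = 0\<close> by (simp add: X_def Y_def \<psi>_def)
    then show ?thesis
      using j0 by (simp add: sum.remove[of _ j0])
  qed
  have G_ends: "G (pi/2) = height (\<theta> j0 + pi/2 + 2 * pi * of_nat k) - height (\<theta> j0 + pi/2)"
    "G (-pi/2) = height (\<theta> j0 + pi/2 - pi + 2 * pi * of_nat k) - height (\<theta> j0 + pi/2 + pi)"
    using sum_j0[of "pi/2"] sum_j0[of "-pi/2"] j0
    by (simp_all add: G_def X_def Y_def \<psi>_def algebra_simps)
  have "\<exists>s. -pi/2 \<le> s \<and> s \<le> pi/2 \<and> G s = 0"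
    using k
  proof
    assume "height (\<theta> j0 + pi/2 + 2 * pi * of_nat k) > height (\<theta> j0 + pi/2) \<and>
     height (\<theta> j0 + pi/2 - pi + 2 * pi * of_nat k) < height (\<theta> j0 + pi/2 + pi)"
    then have "G (-pi/2) \<le> 0" "0 \<le> G (pi/2)"
      unfolding G_ends by linarith+
    then show ?thesis
      by (intro IVT' cont) simp_all
  next
    assume "height (\<theta> j0 + pi/2 + 2 * pi * of_nat k) < height (\<theta> j0 + pi/2) \<and>
     height (\<theta> j0 + pi/2 - pi + 2 * pi * of_nat k) > height (\<theta> j0 + pi/2 + pi)"
    then have "G (pi/2) \<le> 0" "0 \<le> G (-pi/2)"
      unfolding G_ends by linarith+
    then show ?thesis
      by (intro IVT2' cont) simp_all
  qed
  then obtain s where s: "s \<in> {-pi/2..pi/2}" "G s = 0"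
    by auto
  \<comment> \<open>The zero must be interior: at the ends cos s = 0, and the chord would have scale
    0. The strict inequalities for \<open>k\<close> exclude this.\<close>
  have "G (pi/2) \<noteq> 0" "G (-pi/2) \<noteq> 0"
    unfolding G_ends using k by linarith+
  then have "s \<noteq> pi/2" "s \<noteq> -pi/2"
    using s(2) by blast+
  then have "cos s > 0"
    using s(1) by (intro cos_gt_zero_pi) auto
  define c where "c = 2 * cos s / M"
  show ?thesis
  proof (rule that[of "X s" "Y s" c])
    show "X s \<in> topspace (Euclidean_space r)" "Y s \<in> topspace (Euclidean_space r)"
      by (auto simp: X_def Y_def topspace_Euclidean_space)
    show "c \<noteq> 0"
      using \<open>cos s > 0\<close> \<open>M > 0\<close> by (simp add: c_def)
    fix i assume i: "i < 2 * r + 1"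
    have X: "cos (X s j) = cos (\<theta> j + \<psi> s j)" "sin (X s j) = sin (\<theta> j + \<psi> s j)" if "j < r" for j
      using that by (simp_all add: X_def sin_cos_add_2pi_nat)
    have trig: "cos (X s j) - cos (Y s j) = c * v (2 * j)" "sin (X s j) - sin (Y s j) = c * v (2 * j + 1)"
      if "j < r" for j
    proof -
      have "cos (Y s j) = - cos (\<theta> j - \<psi> s j)" "sin (Y s j) = - sin (\<theta> j - \<psi> s j)"
        using that cos_periodic_pi[of "\<theta> j - \<psi> s j"] sin_periodic_pi[of "\<theta> j - \<psi> s j"]
        by (simp_all add: Y_def add_diff_eq diff_add_eq)
      then have "cos (X s j) - cos (Y s j) = 2 * cos (\<theta> j) * cos (\<psi> s j)"
        "sin (X s j) - sin (Y s j) = 2 * sin (\<theta> j) * cos (\<psi> s j)"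
        by (simp_all add: X[OF that] cos_add cos_diff sin_add sin_diff)
      then show "cos (X s j) - cos (Y s j) = c * v (2 * j)" "sin (X s j) - sin (Y s j) = c * v (2 * j + 1)"
        by (simp_all only: cos_\<psi>[OF s(1) that] polar c_def) simp_all
    qed
    show "torus_helix r (X s) i - torus_helix r (Y s) i = c * v i"
    proof (cases "i = 2 * r")
      case True
      then show ?thesis
        using s(2) by (simp add: torus_helix_def G_def c_def sum_subtractf)
    next
      case False
      then have "i < 2 * r"
        using i by simp
      then show ?thesis
        by (rule less_double_cases) (use trig in \<open>simp_all add: torus_helix_def\<close>)
    qed
  qed
qed


section \<open>From chords to indistinguishable points\<close>

text \<open>Covers both responses: \<open>w\<close> is the identity for the first and the moment
  curve for the second. The assumption \<open>span\<close> says that the vectors \<open>w u\<close>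
  span, so the ends of any nontrivial chord parallel to some v are told apart by some input.\<close>

lemma torus_helix_not_distinguishing:
  fixes w :: "'u \<Rightarrow> nat \<Rightarrow> real"
  assumes "r > 0" "finite U0" "card U0 = 2 * r"
    and span: "\<And>v. \<exists>i<2 * r + 1. v i \<noteq> 0 \<Longrightarrow> \<exists>u\<in>U. (\<Sum>i<2 * r + 1. v i * w u i) \<noteq> 0"
  shows "\<not> universal_distinguishing_set (topspace (Euclidean_space r)) U
           (\<lambda>x u. \<Sum>i<2 * r + 1. torus_helix r x i * w u i) U0"
proof
  let ?\<beta> = "\<lambda>x u. \<Sum>i<2 * r + 1. torus_helix r x i * w u i"
  assume uds: "universal_distinguishing_set (topspace (Euclidean_space r)) U ?\<beta> U0"
  \<comment> \<open>\<open>w\<close> may identify inputs, but at most 2r vectors in dimension 2r + 1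
    are left, and some nonzero v is orthogonal to all of them.\<close>
  have "card (w ` U0) < 2 * r + 1"
    using card_image_le[of U0 w] assms by simp
  then obtain v where v: "\<exists>i<2 * r + 1. v i \<noteq> 0"
    and orth: "\<forall>u\<in>w ` U0. (\<Sum>i<2 * r + 1. v i * u i) = 0"
    using ex_orthogonal[of "w ` U0"] assms by blast
  obtain x y c where xy: "x \<in> topspace (Euclidean_space r)" "y \<in> topspace (Euclidean_space r)"
    and "c \<noteq> 0"
    and chord: "\<And>i. i < 2 * r + 1 \<Longrightarrow> torus_helix r x i - torus_helix r y i = c * v i"
    using torus_helix_chord[OF v assms(1)] by blast
  \<comment> \<open>The responses at the two ends differ by a nonzero multiple of the inner product
    with v, which vanishes on all of \<open>U0\<close> but not on all of \<open>U\<close>.\<close>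
  have diff: "?\<beta> x u - ?\<beta> y u = c * (\<Sum>i<2 * r + 1. v i * w u i)" for u
  proof -
    have "?\<beta> x u - ?\<beta> y u = (\<Sum>i<2 * r + 1. (torus_helix r x i - torus_helix r y i) * w u i)"
      by (simp only: left_diff_distrib sum_subtractf)
    also have "\<dots> = (\<Sum>i<2 * r + 1. c * (v i * w u i))"
      by (intro sum.cong) (simp_all add: chord)
    finally show ?thesis
      by (simp only: sum_distrib_left)
  qed
  obtain u where "u \<in> U" "(\<Sum>i<2 * r + 1. v i * w u i) \<noteq> 0"
    using span[OF v] by blast
  then have "?\<beta> x u - ?\<beta> y u \<noteq> 0"
    unfolding diff using \<open>c \<noteq> 0\<close> by (simp only: mult_eq_0_iff) blast
  then have "?\<beta> x u \<noteq> ?\<beta> y u"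
    by (simp only: right_minus_eq not_False_eq_True)
  then obtain u' where u': "u' \<in> U0" "?\<beta> x u' \<noteq> ?\<beta> y u'"
    using uds xy \<open>u \<in> U\<close> unfolding universal_distinguishing_set_def by meson
  have "?\<beta> x u' = ?\<beta> y u'"
    using diff[of u'] orth u'(1) by simp
  with u'(2) show False
    by (rule notE)
qed

section \<open>The two responses\<close>

lemma entire_real_height: "entire_real height"
proof (rule entire_real_of_holomorphic[of "\<lambda>z. z\<^sup>2 * sin z + z * cos z"])
  show "(of_real t)\<^sup>2 * sin (of_real t) + of_real t * cos (of_real t) = (of_real (height t) :: complex)" for t
    by (simp add: height_def sin_of_real cos_of_real)
qed (auto intro!: holomorphic_intros)

lemma real_analytic_map_torus_helix:
  "real_analytic_map_into r (Euclidean_space r) (Euclidean_atlas r) (2 * r + 1) (torus_helix r)"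
  unfolding real_analytic_map_into_def real_analytic_function_Euclidean_atlas
proof (intro conjI allI impI)
  show "torus_helix r ` topspace (Euclidean_space r) \<subseteq> topspace (Euclidean_space (2 * r + 1))"
    by (auto simp: torus_helix_def topspace_Euclidean_space)
  fix i assume "i < 2 * r + 1"
  then consider "i div 2 < r" "i < 2 * r" | "i = 2 * r"
    by fastforce
  then show "real_analytic_on r (topspace (Euclidean_space r)) (\<lambda>x. torus_helix r x i)"
  proof cases
    case 1
    then show ?thesis
      by (cases "even i") (simp_all add: torus_helix_def real_analytic_on_coordinate
          entire_real_cos entire_real_sin)
  next
    case 2
    then show ?thesis
      by (auto simp: torus_helix_def intro!: real_analytic_on_sum real_analytic_on_coordinate
          entire_real_height)
  qed
qed

lemma real_analytic_polynomial_response: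
  "real_analytic_function (r + 1) (product_atlas r (Euclidean_atlas r) real_line_atlas)
     (\<lambda>(x, u). \<Sum>i<2 * r + 1. torus_helix r x i * u ^ i)"
proof (rule real_analytic_function_product_real_line, rule real_analytic_on_sum)
  fix i
  let ?x = "\<lambda>y i. if i < r then y i else (0 :: real)"
  \<comment> \<open>In the product chart the input is coordinate r, just after the r coordinates of
    x, hence distinct from every j < r.\<close>
  have *: "real_analytic_on (r + 1) S (\<lambda>y. g (?x y j) * y r ^ i)" if "entire_real g" "j < r" for S g j
    using that real_analytic_on_mult_coordinates[of g "\<lambda>t. t ^ i" j "r + 1" r S]
    by (simp add: entire_real_power)
  assume "i \<in> {..<2 * r + 1}"
  then consider "i < 2 * r" | "i = 2 * r"
    by fastforce
  then show "real_analytic_on (r + 1) (topspace (Euclidean_space (r + 1)))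
      (\<lambda>y. torus_helix r (?x y) i * y r ^ i)"
  proof cases
    case 1
    then have "i div 2 < r"
      by simp
    with 1 show ?thesis
      using *[OF entire_real_cos \<open>i div 2 < r\<close>] *[OF entire_real_sin \<open>i div 2 < r\<close>]
      by (cases "even i") (simp_all add: torus_helix_def)
  next
    case 2
    have "real_analytic_on (r + 1) S (\<lambda>y. \<Sum>j<r. height (?x y j) * y r ^ i)" for S
      by (intro real_analytic_on_sum *[OF entire_real_height]) simp_all
    with 2 show ?thesis
      by (simp add: torus_helix_def sum_distrib_right)
  qed
qed simp

theorem mainTheorem3:
  fixes r :: nat
  assumes "r > 0"
  shows
    "(\<exists>(X :: (nat \<Rightarrow> real) topology) A f.
        real_analytic_manifold r X A \<and> connected_space X \<and> second_countable X \<and>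
        real_analytic_map_into r X A (2 * r + 1) f \<and>
        (let U = topspace (Euclidean_space (2 * r + 1));
             \<beta> = (\<lambda>x u. \<Sum>i<2 * r + 1. f x i * u i)
         in (\<nexists>U0. finite U0 \<and> card U0 = 2 * r \<and>
                   universal_distinguishing_set (topspace X) U \<beta> U0) \<and>
            distinguishing_tuples (topspace X) U \<beta> (2 * r) = {}))
     \<and>
     (\<exists>(X :: (nat \<Rightarrow> real) topology) A (\<beta> :: (nat \<Rightarrow> real) \<Rightarrow> real \<Rightarrow> real).
        real_analytic_manifold r X A \<and> connected_space X \<and> second_countable X \<and>
        real_analytic_function (r + 1) (product_atlas r A real_line_atlas) (\<lambda>(x, u). \<beta> x u) \<and>
        (\<nexists>U0. finite U0 \<and> card U0 = 2 * r \<and>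
              universal_distinguishing_set (topspace X) UNIV \<beta> U0))"
proof -
  let ?X = "Euclidean_space r" and ?A = "Euclidean_atlas r" and ?U = "topspace (Euclidean_space (2 * r + 1))"
  have X: "real_analytic_manifold r ?X ?A" "connected_space ?X" "second_countable ?X"
    by (rule real_analytic_manifold_Euclidean connected_Euclidean_space second_countable_Euclidean_space)+

  \<comment> \<open>Standard basis vectors pick out the nonzero entries of v.\<close>
  have span_inner: "\<exists>u\<in>?U. (\<Sum>i<2 * r + 1. v i * u i) \<noteq> 0" if "\<exists>i<2 * r + 1. v i \<noteq> 0" for v
  proof -
    obtain k where k: "k < 2 * r + 1" "v k \<noteq> 0"
      using \<open>\<exists>i<2 * r + 1. v i \<noteq> 0\<close> by blast
    have "(\<Sum>i<2 * r + 1. v i * (if i = k then 1 else 0)) = v k"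
      using k by (simp add: if_distrib[of "(*) _"] cong: if_cong)
    with k show ?thesis
      by (intro bexI[of _ "\<lambda>i. if i = k then 1 else 0"]) (auto simp: topspace_Euclidean_space)
  qed
  have no_inner: "\<not> universal_distinguishing_set (topspace ?X) ?U
      (\<lambda>x u. \<Sum>i<2 * r + 1. torus_helix r x i * u i) U0" if "finite U0" "card U0 = 2 * r" for U0
    using torus_helix_not_distinguishing[of r U0 ?U "\<lambda>u. u"] assms that span_inner by blast
  \<comment> \<open>A tuple of 2r distinct inputs has an underlying set of cardinality 2r, so the
    claim on sets applies.\<close>
  have "us \<notin> distinguishing_tuples (topspace ?X) ?U
      (\<lambda>x u. \<Sum>i<2 * r + 1. torus_helix r x i * u i) (2 * r)" for us
    using no_inner[of "set us"] distinct_card[of us]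
    unfolding distinguishing_tuples_def distinct_tuples_def by fastforce
  then have "distinguishing_tuples (topspace ?X) ?U
      (\<lambda>x u. \<Sum>i<2 * r + 1. torus_helix r x i * u i) (2 * r) = {}"
    by blast
  then have a: "let U = ?U; \<beta> = (\<lambda>x u. \<Sum>i<2 * r + 1. torus_helix r x i * u i)
     in (\<nexists>U0. finite U0 \<and> card U0 = 2 * r \<and> universal_distinguishing_set (topspace ?X) U \<beta> U0) \<and>
        distinguishing_tuples (topspace ?X) U \<beta> (2 * r) = {}"
    unfolding Let_def using no_inner by blast

  \<comment> \<open>A real polynomial that vanishes at every point has only zero coefficients, so
    the moment curve lies in no hyperplane through the origin.\<close>
  have span_poly: "\<exists>u\<in>UNIV. (\<Sum>i<2 * r + 1. v i * u ^ i) \<noteq> 0"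
    if "\<exists>i<2 * r + 1. v i \<noteq> 0" for v :: "nat \<Rightarrow> real"
    using that Transcendental.polyfun_eq_0[where n = "2 * r" and c = v]
    by (auto simp: less_Suc_eq_le simp flip: lessThan_Suc_atMost)
  have b: "\<nexists>U0. finite U0 \<and> card U0 = 2 * r \<and> universal_distinguishing_set (topspace ?X) UNIV
      (\<lambda>x u. \<Sum>i<2 * r + 1. torus_helix r x i * u ^ i) U0"
    using torus_helix_not_distinguishing[of r _ UNIV "\<lambda>u i. u ^ i"] assms span_poly by blast

  show ?thesis
    by (rule conjI; intro exI conjI)
      (rule X real_analytic_map_torus_helix a real_analytic_polynomial_response b)+
qed

end
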